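(* Let $(B_n)_{n\ge 0}$ be the sequence of rational numbers defined by $B_0=1$ and $\sum_{k=0}^{n-1}\binom{n}{k}B_k=0$ for all integers $n\ge 2$. Then for every integer $n\ge 1$, $$\sum_{k=0}^{n}\binom{n}{k}\frac{B_k}{n+2-k}=\frac{B_{n+1}}{n+1}.$$
   Context: The numbers $B_n$ are the Bernoulli numbers (with the convention $B_1=-\tfrac12$, as follows from the defining relation for $n=2$). *)

theory Defs
  imports Complex_Main
begin

end

theory Submission
  imports Defs
begin

text \<open>For \<open>k \<le> n\<close> one has
  \<open>(n choose k) / (n+2-k) = ((n+1 choose k) - (n+2 choose k) / (n+2)) / (n+1)\<close>.
  Multiply by \<open>B k\<close> and sum over \<open>k \<le> n\<close>: the recurrence for \<open>m = n+1\<close> removes the first part,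
  and the one for \<open>m = n+2\<close> reduces the second to its missing term \<open>k = n+1\<close>.\<close>

lemma binomial_absorb_comp_of_nat:
  fixes n k :: nat
  assumes "k \<le> n"
  shows "(of_nat n + 1 - of_nat k) * of_nat (Suc n choose k)
           = (of_nat n + 1) * (of_nat (n choose k) :: 'a :: comm_ring_1)"
proof -
  have "of_nat ((Suc n - k) * (Suc n choose k)) = (of_nat (Suc n * (n choose k)) :: 'a)"
    using binomial_absorb_comp[of "Suc n" k] by simp
  then show ?thesis
    using assms unfolding of_nat_mult by (simp add: of_nat_diff algebra_simps)
qed

text \<open>Absorption is used twice. From \<open>n + 1\<close> to \<open>n + 2\<close> it turns
  \<open>c / (N + 2)\<close> into \<open>b / (N + 2 - K)\<close>; from \<open>n\<close> to
  \<open>n + 1\<close> it turns the remaining numerator \<open>(N + 1 - K) * b\<close> into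
  \<open>(N + 1) * a\<close>.\<close>

lemma binomial_div_eq:
  fixes n k :: nat
  assumes "k \<le> n"
  shows "of_nat (n choose k) / (of_nat n + 2 - of_nat k)
           = (of_nat (n + 1 choose k) - of_nat (n + 2 choose k) / (of_nat n + 2))
               / (of_nat n + 1 :: 'a :: field_char_0)"
proof -
  define N K :: 'a where "N = of_nat n" and "K = of_nat k"
  define a b c :: 'a where "a = of_nat (n choose k)" and "b = of_nat (n + 1 choose k)"
    and "c = of_nat (n + 2 choose k)"
  have b: "(N + 1 - K) * b = (N + 1) * a"
    using binomial_absorb_comp_of_nat[OF assms, where ?'a = 'a]
    by (simp add: N_def K_def a_def b_def)
  have c: "(N + 2 - K) * c = (N + 2) * b"
    using binomial_absorb_comp_of_nat[of k "Suc n", where ?'a = 'a] assms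
    by (simp add: N_def K_def b_def c_def add_ac)
  \<comment> \<open>Each denominator is the cast of a positive natural number, hence nonzero in
    characteristic 0.\<close>
  have "N + 2 - K = of_nat (n + 2 - k)"
    using assms by (simp add: N_def K_def of_nat_diff)
  moreover have "N + 1 = of_nat (n + 1)" "N + 2 = of_nat (n + 2)"
    by (simp_all add: N_def)
  ultimately have nz: "N + 2 - K \<noteq> 0" "N + 1 \<noteq> 0" "N + 2 \<noteq> 0"
    using assms by (simp_all only: of_nat_eq_0_iff)
  have c': "c / (N + 2) = b / (N + 2 - K)"
    using c nz by (simp add: frac_eq_eq mult.commute)
  have "b - b / (N + 2 - K) = (N + 1 - K) * b / (N + 2 - K)"
    using nz by (simp add: divide_simps) (simp add: algebra_simps)
  then have "(b - c / (N + 2)) / (N + 1) = a / (N + 2 - K)"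
    using nz unfolding c' b by simp
  then show ?thesis
    by (simp only: N_def K_def a_def b_def c_def)
qed

theorem mainTheorem2:
  fixes B :: "nat \<Rightarrow> rat" and n :: nat
  assumes B_0: "B 0 = 1"
    and B_rec: "\<And>m::nat. m \<ge> 2 \<Longrightarrow> (\<Sum>k=0..m-1. of_nat (m choose k) * B k) = 0"
    and n: "n \<ge> 1"
  shows "(\<Sum>k=0..n. of_nat (n choose k) * (B k / (of_nat n + 2 - of_nat k)))
           = B (n + 1) / (of_nat n + 1)"
proof -
  let ?S = "\<lambda>m l. \<Sum>k=0..l. of_nat (m choose k) * B k"
  \<comment> \<open>The recurrence requires \<open>m \<ge> 2\<close>, so taking
    \<open>m = n + 1\<close> uses \<open>n \<ge> 1\<close>.\<close>
  have S1: "?S (n + 1) n = 0"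
    using B_rec[of "n + 1"] n by simp
  have "?S (n + 2) (n + 1) = 0"
    using B_rec[of "n + 2"] by simp
  \<comment> \<open>The top term has coefficient \<open>n + 2 choose (n + 1)\<close>, which is
    \<open>n + 2\<close>. Pascal's rule is switched off so that it does not expand the binomials
    first.\<close>
  moreover have "?S (n + 2) (n + 1) = ?S (n + 2) n + (of_nat n + 2) * B (n + 1)"
    by (simp add: binomial_Suc_n add_ac del: binomial_Suc_Suc)
  ultimately have "?S (n + 2) n = - ((of_nat n + 2) * B (n + 1))"
    by (simp only: eq_neg_iff_add_eq_0)
  moreover have "(of_nat n + 2 :: rat) \<noteq> 0"
    using of_nat_0_le_iff[of n, where ?'a = rat] by linarith
  ultimately have S2: "?S (n + 2) n / (of_nat n + 2) = - B (n + 1)"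
    by simp
  have "(\<Sum>k=0..n. of_nat (n choose k) * (B k / (of_nat n + 2 - of_nat k)))
      = (\<Sum>k=0..n. (of_nat (n + 1 choose k) * B k
            - of_nat (n + 2 choose k) * B k / (of_nat n + 2)) / (of_nat n + 1))"
  proof (rule sum.cong[OF refl])
    fix k assume "k \<in> {0..n}"
    \<comment> \<open>\<open>B k\<close> is kept outside the quotient so that the left side contains
      exactly the quotient of \<open>binomial_div_eq\<close>.\<close>
    then have "of_nat (n choose k) / (of_nat n + 2 - of_nat k) * B k
        = (of_nat (n + 1 choose k) - of_nat (n + 2 choose k) / (of_nat n + 2))
            / (of_nat n + 1) * B k"
      by (subst binomial_div_eq) auto
    then show "of_nat (n choose k) * (B k / (of_nat n + 2 - of_nat k))
        = (of_nat (n + 1 choose k) * B k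
            - of_nat (n + 2 choose k) * B k / (of_nat n + 2)) / (of_nat n + 1)"
      by (simp only: left_diff_distrib times_divide_eq_left times_divide_eq_right)
  qed
  also have "\<dots> = (?S (n + 1) n - ?S (n + 2) n / (of_nat n + 2)) / (of_nat n + 1)"
    by (simp only: sum_subtractf flip: sum_divide_distrib)
  also have "\<dots> = B (n + 1) / (of_nat n + 1)"
    unfolding S1 S2 by simp
  finally show ?thesis .
qed

end
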